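(* Let $G=(V,E)$ be a finite simple graph of order $n\ge 4$. Assume that every induced subgraph of $G$ of order $n-1$ and every induced subgraph of $G$ of order $n-2$ is switching separable. Then $G$ is switching separable.
   Context: All graphs are finite and simple; "subgraph" always means induced subgraph. For a graph $G=(V,E)$ and a set $U\subseteq V$ (possibly empty or equal to $V$), the $U$-switching of $G$ is the graph $G_U=(V,E\,\triangle\, E_{U,V\setminus U})$, where $E_{U,V\setminus U}$ is the edge set of the complete bipartite graph on $V$ with parts $U$ and $V\setminus U$, and $\triangle$ is symmetric difference. A set $W\subseteq V$ is called isolable if $2\le |W|\le |V|-2$ and some switching $G_U$ of $G$ contains no edge joining a vertex of $W$ to a vertex of $V\setminus W$. A graph is called switching separable if its vertex set contains an isolable subset. *)

theory Defs
  imports "HOL-Library.Ramsey"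
begin

text \<open>Edges are two-element subsets of the vertex set, so every simple graph is encoded uniquely.\<close>

definition simple_graph :: "'a set \<Rightarrow> 'a set set \<Rightarrow> bool" where
  "simple_graph V E \<longleftrightarrow> finite V \<and> E \<subseteq> [V]\<^bsup>2\<^esup>"

definition induced_edges :: "'a set set \<Rightarrow> 'a set \<Rightarrow> 'a set set" where
  "induced_edges E S = {e \<in> E. e \<subseteq> S}"

definition complete_bipartite_edges :: "'a set \<Rightarrow> 'a set \<Rightarrow> 'a set set" where
  "complete_bipartite_edges A B = {{a, b} | a b. a \<in> A \<and> b \<in> B}"

definition switching :: "'a set \<Rightarrow> 'a set set \<Rightarrow> 'a set \<Rightarrow> 'a set set" where
  "switching V E U = sym_diff E (complete_bipartite_edges U (V - U))"

text \<open>The size condition is stated additively, since subtraction on \<^typ>\<open>nat\<close> truncates.\<close>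

definition isolable :: "'a set \<Rightarrow> 'a set set \<Rightarrow> 'a set \<Rightarrow> bool" where
  "isolable V E W \<longleftrightarrow> W \<subseteq> V \<and> 2 \<le> card W \<and> card W + 2 \<le> card V \<and>
     (\<exists>U \<subseteq> V. \<forall>w \<in> W. \<forall>v \<in> V - W. {w, v} \<notin> switching V E U)"

definition switching_separable :: "'a set \<Rightarrow> 'a set set \<Rightarrow> bool" where
  "switching_separable V E \<longleftrightarrow> (\<exists>W. isolable V E W)"

end

theory Submission
  imports Defs
begin

text \<open>
  Up to its size, \<open>W\<close> is isolable iff all \<open>2 \<times> 2\<close> submatrices of the adjacency matrix between \<open>W\<close> and its
  complement have even sum, a condition that restricts to induced subgraphs.
  Let \<open>X\<close> induce a nonseparable subgraph with \<open>4 \<le> card X \<le> card V - 2\<close>. A vertex \<open>x\<close> outside \<open>X\<close> is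
  paired with at most one \<open>u \<in> X\<close> such that \<open>{u, x}\<close> is isolable in \<open>X \<union> {x}\<close>. If every extension
  of \<open>X\<close> by two vertices is separable, then either some \<open>u\<close> together with all vertices paired with
  it is isolable in \<open>V\<close>, or no vertex is paired and \<open>V - X\<close> is isolable (this is the switching
  version of the Ehrenfeucht--Rozenberg theorem on prime graphs). So nonseparable subgraphs of a
  nonseparable graph grow in steps of two up to order \<open>n - 1\<close> or \<open>n - 2\<close>. They start at order \<open>5\<close>:
  switch so that \<open>p\<close> is isolated; if the rest contains an induced path on four vertices, that path
  with \<open>p\<close> is nonseparable, and otherwise the rest is a cograph, which yields an isolable set.
\<close>

section \<open>Isolable sets as a parity condition on a symmetric relation\<close>

locale symmetric_relation =
  fixes e :: "'a \<Rightarrow> 'a \<Rightarrow> bool"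
  assumes sym: "e x y = e y x"
begin

text \<open>Any two rows of the block between \<open>W\<close> and \<open>Z\<close> are equal or
  complementary. Switching adds mod 2 a term depending on the row and a term depending on the
  column; both cancel here, so no set \<open>U\<close> occurs.\<close>

definition splits :: "'a set \<Rightarrow> 'a set \<Rightarrow> bool" where
  "splits W Z \<longleftrightarrow> (\<forall>w\<in>W. \<forall>w'\<in>W. \<forall>v\<in>Z. \<forall>v'\<in>Z. (e w v = e w v') = (e w' v = e w' v'))"

definition separable :: "'a set \<Rightarrow> bool" where
  "separable S \<longleftrightarrow> (\<exists>W\<subseteq>S. 2 \<le> card W \<and> 2 \<le> card (S - W) \<and> splits W (S - W))"

lemma splitsD:
  "splits W Z \<Longrightarrow> w \<in> W \<Longrightarrow> w' \<in> W \<Longrightarrow> v \<in> Z \<Longrightarrow> v' \<in> Z \<Longrightarrow>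
    (e w v = e w v') = (e w' v = e w' v')"
  unfolding splits_def by blast

lemma splits_mono:
  assumes "splits W Z" "W' \<subseteq> W" "Z' \<subseteq> Z"
  shows "splits W' Z'"
  unfolding splits_def
proof (intro ballI)
  fix w w' v v'
  assume "w \<in> W'" "w' \<in> W'" "v \<in> Z'" "v' \<in> Z'"
  then show "(e w v = e w v') = (e w' v = e w' v')"
    by (intro splitsD[OF assms(1)] subsetD[OF assms(2)] subsetD[OF assms(3)])
qed

lemma splits_commute:
  assumes "splits W Z"
  shows "splits Z W"
  unfolding splits_def
proof (intro ballI)
  fix w w' v v'
  assume "v \<in> Z" "v' \<in> Z" "w \<in> W" "w' \<in> W"
  then have "(e w v = e w v') = (e w' v = e w' v')"
    by (intro splitsD[OF assms])
  then show "(e v w = e v w') = (e v' w = e v' w')"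
    unfolding sym[of v] sym[of v'] by argo
qed

text \<open>Comparing rows mod 2 is transitive, so it suffices to compare every row with that of one
  anchor \<open>a\<close>.\<close>

lemma splits_pairwise:
  assumes "\<And>w. w \<in> W \<Longrightarrow> splits {a, w} Z"
  shows "splits W Z"
  unfolding splits_def
proof (intro ballI)
  fix w w' v v'
  assume H: "w \<in> W" "w' \<in> W" "v \<in> Z" "v' \<in> Z"
  have "(e a v = e a v') = (e w v = e w v')" "(e a v = e a v') = (e w' v = e w' v')"
    using splitsD[OF assms] H by blast+
  then show "(e w v = e w v') = (e w' v = e w' v')" by simp
qed

lemma splits_pairD:
  assumes "splits {a, b} Z" "z \<in> Z" "t \<in> Z"
  shows "(e a z = e b z) = (e a t = e b t)"
proof -
  have "(e a z = e a t) = (e b z = e b t)" by (rule splitsD[OF assms(1)]) (use assms in simp_all)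
  then show ?thesis by argo
qed

text \<open>The constant \<open>c\<close> records which alternative holds: equal rows if true,
  complementary rows if false.\<close>

lemma splits_pairI:
  assumes "\<And>z. z \<in> Z \<Longrightarrow> (e a z = e b z) = c"
  shows "splits {a, b} Z"
proof -
  have "(e a v = e a v') = (e b v = e b v')" if "v \<in> Z" "v' \<in> Z" for v v'
    using assms[OF that(1)] assms[OF that(2)] by argo
  then show ?thesis unfolding splits_def by simp
qed

lemma splits_pairE:
  assumes "splits {a, b} Z"
  obtains c where "\<And>z. z \<in> Z \<Longrightarrow> (e a z = e b z) = c"
proof (cases "Z = {}")
  case True
  then show ?thesis using that by simp
next
  case False
  then obtain t where "t \<in> Z" by auto
  then show ?thesis by (intro that[of "e a t = e b t"] splits_pairD[OF assms])
qed

lemma not_separable_card: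
  assumes "\<not> separable X" "splits W (X - W)" "W \<subseteq> X" "2 \<le> card W"
  shows "card (X - W) \<le> 1"
  using assms unfolding separable_def by force

text \<open>A split of \<open>T\<close> restricts to \<open>X\<close>. As \<open>X\<close> is
  nonseparable, one of the two sides meets \<open>X\<close> in at most one vertex; by symmetry of
  the split that side may be called \<open>W\<close>.\<close>

lemma separable_extension_cases:
  assumes fin: "finite T" and "X \<subseteq> T" "\<not> separable X" "separable T"
  obtains W where "W \<subseteq> T" "2 \<le> card W" "splits W (T - W)" "card (W \<inter> X) \<le> 1"
proof -
  obtain W where W: "W \<subseteq> T" "2 \<le> card W" "2 \<le> card (T - W)" "splits W (T - W)"
    using assms(4) unfolding separable_def by blast
  show thesis
  proof (cases "card (W \<inter> X) \<le> 1")
    case True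
    then show ?thesis using that W by blast
  next
    case False
    have "splits (W \<inter> X) (X - (W \<inter> X))"
      using W(4) by (rule splits_mono) (use assms(2) in auto)
    then have "card (X - (W \<inter> X)) \<le> 1"
      using not_separable_card[of X "W \<inter> X"] assms(3) False by auto
    moreover have "(T - W) \<inter> X = X - (W \<inter> X)" using assms(2) by blast
    moreover have "T - (T - W) = W" using W(1) by blast
    ultimately show ?thesis
      using that[of "T - W"] W splits_commute by auto
  qed
qed

section \<open>Twins and extensions of a nonseparable set by two vertices\<close>

text \<open>The pair \<open>{u, x}\<close> is isolable in \<open>S\<close>, for \<open>card S \<ge> 4\<close>.\<close>

definition twins :: "'a set \<Rightarrow> 'a \<Rightarrow> 'a \<Rightarrow> bool" where
  "twins S u x \<longleftrightarrow> splits {u, x} (S - {u, x})"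

lemma twins_mono: "twins S u x \<Longrightarrow> S' \<subseteq> S \<Longrightarrow> twins S' u x"
  unfolding twins_def by (erule splits_mono) auto

lemma not_twins:
  assumes "\<not> separable X" "finite X" "4 \<le> card X" "u \<in> X" "v \<in> X" "u \<noteq> v"
  shows "\<not> twins X u v"
proof
  assume "twins X u v"
  moreover have "card (X - {u, v}) = card X - 2"
    using assms by (simp add: card_Diff_subset)
  ultimately show False
    using not_separable_card[of X "{u, v}"] assms unfolding twins_def by auto
qed

text \<open>The constants of the two pairs add mod 2. Only the column of the middle vertex
  \<open>x\<close> needs an extra argument.\<close>

lemma twins_trans:
  assumes "twins S a x" "twins S x b" "a \<in> S" "b \<in> S" "x \<in> S" "a \<noteq> b" "x \<noteq> a" "x \<noteq> b"
  shows "twins S a b"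
proof -
  obtain c where c: "\<And>z. z \<in> S - {a, x} \<Longrightarrow> (e a z = e x z) = c"
    using assms(1) unfolding twins_def by (rule splits_pairE) (rule that)
  obtain d where d: "\<And>z. z \<in> S - {x, b} \<Longrightarrow> (e x z = e b z) = d"
    using assms(2) unfolding twins_def by (rule splits_pairE) (rule that)
  have "(e a z = e b z) = (c = d)" if "z \<in> S - {a, b}" for z
  proof (cases "z = x")
    case True
    \<comment> \<open>Neither hypothesis covers column \<open>x\<close>. By symmetry of
      \<open>e\<close>, row \<open>a\<close> at \<open>x\<close> is compared with the entry at
      \<open>a\<close>, \<open>b\<close> through \<open>d\<close>, and that entry with row
      \<open>b\<close> at \<open>x\<close> through \<open>c\<close>.\<close>
    then show ?thesis using c[of b] d[of a] assms sym[of x a] sym[of x b] sym[of a b] by auto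
  next
    case False
    then show ?thesis using c[of z] d[of z] that by auto
  qed
  then show ?thesis unfolding twins_def by (rule splits_pairI)
qed

text \<open>Two partners of \<open>x\<close> would be twins of each other by transitivity, and a
  pair of twins inside \<open>X\<close> would separate it.\<close>

lemma twins_unique:
  assumes "\<not> separable X" "finite X" "4 \<le> card X" "u \<in> X" "v \<in> X" "x \<notin> X"
    "twins (insert x X) u x" "twins (insert x X) v x"
  shows "u = v"
proof (rule ccontr)
  assume "u \<noteq> v"
  have "twins (insert x X) x v" using assms(8) unfolding twins_def by (simp add: insert_commute)
  then have "twins (insert x X) u v"
    using twins_trans[OF assms(7)] assms \<open>u \<noteq> v\<close> by blast
  then have "twins X u v" by (rule twins_mono) blast
  then show False using not_twins assms \<open>u \<noteq> v\<close> by blast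
qed

text \<open>The side \<open>W\<close> that meets \<open>X\<close> in at most one vertex is contained
  in \<open>{v, x, y}\<close> and has at least two elements; the cases list what remains.\<close>

lemma two_extension_cases:
  assumes "\<not> separable X" "finite X" "x \<notin> X" "y \<notin> X" "x \<noteq> y"
    and "separable (insert x (insert y X))" (is "separable ?T")
  obtains "twins ?T x y"
  | v where "v \<in> X" "twins ?T v x"
  | v where "v \<in> X" "twins ?T v y"
  | v where "v \<in> X" "splits {v, x, y} (X - {v})"
proof -
  obtain W where W: "W \<subseteq> ?T" "2 \<le> card W" "splits W (?T - W)" "card (W \<inter> X) \<le> 1"
    using separable_extension_cases[OF _ _ assms(1) assms(6)] assms(2) by blast
  have finW: "finite W" using W(1) assms(2) finite_subset by blast
  show thesis
  proof (cases "W \<inter> X = {}")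
    case True
    then have "W \<subseteq> {x, y}" using W(1) by blast
    moreover have "card {x, y} = 2" using assms(5) by simp
    ultimately have "W = {x, y}"
      using W(2) by (metis card_seteq finite.emptyI finite.insertI)
    then show ?thesis using W(3) that(1) unfolding twins_def by blast
  next
    case False
    then obtain v where v: "v \<in> W" "v \<in> X" by blast
    have "W \<inter> X = {v}"
      using W(4) v finW card_le_Suc0_iff_eq[of "W \<inter> X"] by auto
    then have sub: "{v} \<subseteq> W" "W \<subseteq> {v, x, y}" using W(1) v by auto
    have "W \<noteq> {v}" using W(2) by auto
    then consider "W = {v, x}" | "W = {v, y}" | "W = {v, x, y}"
      using sub by blast
    then show ?thesis
    proof cases
      case 1
      then show ?thesis using W(3) that(2) v unfolding twins_def by blast
    next
      case 2
      then show ?thesis using W(3) that(3) v unfolding twins_def by blast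
    next
      case 3
      have "splits {v, x, y} (X - {v})"
        using W(3) unfolding 3 by (rule splits_mono) (use assms in auto)
      then show ?thesis using that(4) v by blast
    qed
  qed
qed

text \<open>Adding a vertex \<open>y\<close> not paired with \<open>u\<close> does not destroy the
  pair \<open>u\<close>, \<open>x\<close>. Twins \<open>x\<close>, \<open>y\<close>, or a split by
  \<open>{v, x, y}\<close> (where uniqueness forces \<open>v = u\<close>), would pair
  \<open>y\<close> with \<open>u\<close>. A twin of \<open>x\<close> in \<open>X\<close> must be
  \<open>u\<close>. The case of a twin of \<open>y\<close> is settled by copying a column.\<close>

lemma twins_extend:
  assumes X: "\<not> separable X" "finite X" "4 \<le> card X"
    and xy: "x \<notin> X" "y \<notin> X" "x \<noteq> y" "u \<in> X"
    and x: "twins (insert x X) u x" and y: "\<not> twins (insert y X) u y"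
    and T: "separable (insert x (insert y X))"
  shows "twins (insert x (insert y X)) u x"
proof -
  let ?T = "insert x (insert y X)"
  have xX: "insert x X - {u, x} = X - {u}" using xy by auto
  obtain c where c: "\<And>z. z \<in> X - {u} \<Longrightarrow> (e u z = e x z) = c"
    using x unfolding twins_def xX by (rule splits_pairE) (rule that)
  have yX: "insert y X - {u, y} = X - {u}" using xy by blast
  show ?thesis
    using X(1,2) xy(1-3) T
  proof (cases rule: two_extension_cases)
    case 1
    have "?T - {x, y} = X" using xy by auto
    with 1 have "splits {x, y} X" unfolding twins_def by simp
    then obtain d where d: "\<And>z. z \<in> X \<Longrightarrow> (e x z = e y z) = d"
      by (rule splits_pairE) (rule that)
    have "(e u z = e y z) = (c = d)" if "z \<in> X - {u}" for z
      using c[of z] d[of z] that by auto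
    then have "twins (insert y X) u y"
      unfolding twins_def yX by (rule splits_pairI)
    then show ?thesis using y by blast
  next
    case (2 v)
    have "twins (insert x X) v x" using 2(2) by (rule twins_mono) blast
    then have "u = v" using twins_unique[OF X xy(4) 2(1) xy(1) x] by blast
    then show ?thesis using 2 by blast
  next
    case (3 v)
    have "twins (insert y X) v y" using 3(2) by (rule twins_mono) blast
    then have "u \<noteq> v" using y by blast
    obtain d where d: "\<And>z. z \<in> ?T - {v, y} \<Longrightarrow> (e v z = e y z) = d"
      using 3(2) unfolding twins_def by (rule splits_pairE) (rule that)
    \<comment> \<open>Since \<open>v\<close> and \<open>y\<close> are twins, the block with rows
      \<open>u\<close>, \<open>x\<close> and columns \<open>v\<close>, \<open>y\<close> has even
      sum. So rows \<open>u\<close> and \<open>x\<close> compare at the new column \<open>y\<close>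
      as they do at \<open>v\<close>, where the constant is \<open>c\<close>.\<close>
    have "(e v u = e y u) = d" "(e v x = e y x) = d"
      using d[of u] d[of x] 3(1) xy \<open>u \<noteq> v\<close> by auto
    moreover have "(e u v = e x v) = c" using c[of v] 3(1) \<open>u \<noteq> v\<close> by simp
    moreover have "e y u = e u y" "e y x = e x y" "e v u = e u v" "e v x = e x v"
      by (rule sym)+
    ultimately have y: "(e u y = e x y) = c" by argo
    have "(e u z = e x z) = c" if "z \<in> ?T - {u, x}" for z
    proof (cases "z = y")
      case False
      then show ?thesis using that by (intro c) auto
    qed (simp add: y)
    then show ?thesis unfolding twins_def by (rule splits_pairI)
  next
    case (4 v)
    have eq: "insert x X - {v, x} = X - {v}" "insert y X - {v, y} = X - {v}"
      using xy 4(1) by auto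
    have "twins (insert x X) v x" "twins (insert y X) v y"
      unfolding twins_def eq using 4(2) by (auto elim!: splits_mono)
    moreover have "u = v"
      using twins_unique[OF X xy(4) 4(1) xy(1) x] calculation(1) .
    ultimately show ?thesis using y by simp
  qed
qed

text \<open>In each of the other three cases, deleting one of the two new vertices leaves the other
  one paired with a vertex of \<open>X\<close>.\<close>

lemma no_twins_extend:
  assumes X: "\<not> separable X" "finite X"
    and xy: "x \<notin> X" "y \<notin> X" "x \<noteq> y"
    and x: "\<And>u. u \<in> X \<Longrightarrow> \<not> twins (insert x X) u x"
    and y: "\<And>u. u \<in> X \<Longrightarrow> \<not> twins (insert y X) u y"
    and T: "separable (insert x (insert y X))"
  shows "twins (insert x (insert y X)) x y"
  using X xy T
proof (cases rule: two_extension_cases)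
  case (2 v)
  have "twins (insert x X) v x" using 2(2) by (rule twins_mono) blast
  then show ?thesis using x[OF 2(1)] by contradiction
next
  case (3 v)
  have "twins (insert y X) v y" using 3(2) by (rule twins_mono) blast
  then show ?thesis using y[OF 3(1)] by contradiction
next
  case (4 v)
  have "insert x X - {v, x} = X - {v}" using xy by auto
  then have "twins (insert x X) v x"
    unfolding twins_def using 4(2) by (auto elim!: splits_mono)
  then show ?thesis using x[OF 4(1)] by contradiction
qed

lemma nonseparable_two_extension:
  assumes V: "\<not> separable V" "finite V"
    and X: "\<not> separable X" "X \<subseteq> V" "4 \<le> card X" "card X + 2 \<le> card V"
  shows "\<exists>Y\<subseteq>V. card Y = card X + 2 \<and> \<not> separable Y"
proof (rule ccontr)
  assume no_ext: "\<not> ?thesis"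
  have finX: "finite X" using X V finite_subset by auto
  have T: "separable (insert x (insert y X))" if "x \<in> V" "x \<notin> X" "y \<in> V" "y \<notin> X" "x \<noteq> y" for x y
  proof -
    have "card (insert x (insert y X)) = card X + 2" using that finX by simp
    moreover have "insert x (insert y X) \<subseteq> V" using that X by auto
    ultimately show ?thesis using no_ext by simp
  qed
  show False
  proof (cases "\<exists>x u. x \<in> V \<and> x \<notin> X \<and> u \<in> X \<and> twins (insert x X) u x")
    case True
    then obtain x u where x: "x \<in> V" "x \<notin> X" and u: "u \<in> X" and xu: "twins (insert x X) u x"
      by (elim exE conjE)
    \<comment> \<open>Every vertex paired with \<open>u\<close> must join \<open>u\<close>: then any
      vertex \<open>z\<close> outside both \<open>M\<close> and \<open>X\<close> satisfies the
      negative hypothesis of \<open>twins_extend\<close>.\<close>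
    define M where "M = insert u {w \<in> V. w \<notin> X \<and> twins (insert w X) u w}"
    \<comment> \<open>The vertex \<open>t\<close> lies outside \<open>M\<close> and serves as
      reference column: every other column is compared with it.\<close>
    have "0 < card (X - {u})" using u X(3) by simp
    then obtain t where t: "t \<in> X" "t \<noteq> u" by (auto simp: card_gt_0_iff)
    have "splits {u, w} (V - M)" if "w \<in> M" for w
    proof (cases "w = u")
      case True
      then show ?thesis by (intro splits_pairI[where c = True]) simp
    next
      case False
      then have w: "w \<in> V" "w \<notin> X" "twins (insert w X) u w" using that unfolding M_def by auto
      show ?thesis
      proof (rule splits_pairI)
        fix z assume z: "z \<in> V - M"
        then have "z \<noteq> u" "z \<noteq> w" using that unfolding M_def by auto
        show "(e u z = e w z) = (e u t = e w t)"
        proof (cases "z \<in> X")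
          case True
          show ?thesis
            using w(3) unfolding twins_def
            by (rule splits_pairD) (use True w t \<open>z \<noteq> u\<close> in auto)
        next
          case False
          then have "\<not> twins (insert z X) u z" using z unfolding M_def by simp
          then have "twins (insert w (insert z X)) u w"
            using w u z False \<open>z \<noteq> w\<close> by (intro twins_extend[OF X(1) finX X(3)] T) auto
          then show ?thesis unfolding twins_def
            by (rule splits_pairD) (use w t \<open>z \<noteq> u\<close> \<open>z \<noteq> w\<close> in auto)
        qed
      qed
    qed
    then have M: "splits M (V - M)" by (rule splits_pairwise)
    have MV: "M \<subseteq> V" using u X(2) unfolding M_def by auto
    have "card {u, x} \<le> card M"
      by (rule card_mono[OF finite_subset[OF MV V(2)]]) (use x u xu in \<open>auto simp: M_def\<close>)
    moreover have "u \<noteq> x" using x u by auto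
    ultimately have "2 \<le> card M" by simp
    then have "card (V - M) \<le> 1" using not_separable_card[OF V(1) M MV] by simp
    \<comment> \<open>The complement of \<open>M\<close> contains \<open>X - {u}\<close>, which has
      at least three vertices.\<close>
    moreover have "card (X - {u}) \<le> card (V - M)"
      by (rule card_mono) (use V(2) X(2) in \<open>auto simp: M_def\<close>)
    ultimately show False using X(3) u by simp
  next
    case False
    have card: "card (V - X) \<ge> 2" using X V(2) finX by (simp add: card_Diff_subset)
    then have "V - X \<noteq> {}" by force
    then obtain x where x: "x \<in> V" "x \<notin> X" by auto
    \<comment> \<open>With no vertex outside \<open>X\<close> paired, any two of them are twins;
      \<open>x\<close> is the anchor for \<open>splits_pairwise\<close>.\<close>
    have "splits {x, y} X" if y: "y \<in> V - X" for y
    proof (cases "x = y")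
      case True
      then show ?thesis by (intro splits_pairI[where c = True]) simp
    next
      case neq: False
      have "\<not> twins (insert z X) u z" if "z \<in> V" "z \<notin> X" "u \<in> X" for z u
        using False that by blast
      then have "twins (insert x (insert y X)) x y"
        using x y neq by (intro no_twins_extend[OF X(1) finX] T) auto
      then show ?thesis unfolding twins_def by (rule splits_mono) (use x y in auto)
    qed
    then have "splits (V - X) X" by (rule splits_pairwise)
    then have "splits X (V - X)" by (rule splits_commute)
    then have "card (V - X) \<le> 1" using not_separable_card[OF V(1) _ X(2)] X(3) by simp
    then show False using card by simp
  qed
qed

end

section \<open>Decomposition of graphs without an induced path on four vertices\<close>

definition induces_P4 :: "('a \<Rightarrow> 'a \<Rightarrow> bool) \<Rightarrow> 'a \<Rightarrow> 'a \<Rightarrow> 'a \<Rightarrow> 'a \<Rightarrow> bool" where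
  "induces_P4 h a b c d \<longleftrightarrow> distinct [a, b, c, d] \<and>
     h a b \<and> h b c \<and> h c d \<and> \<not> h a c \<and> \<not> h a d \<and> \<not> h b d"

text \<open>If \<open>v\<close> has no neighbour in one of the parts, it joins the other part.
  Otherwise no neighbour of \<open>v\<close> is adjacent to a non-neighbour, so \<open>v\<close>
  with its neighbours is cut off from the non-neighbours; if there are none of these,
  \<open>v\<close> is joined to everything.\<close>

lemma P4_free_step:
  assumes sym: "\<And>x y. h x y = h y x"
    and free: "\<And>a b c d. {a, b, c, d} \<subseteq> insert v (A \<union> B) \<Longrightarrow> \<not> induces_P4 h a b c d"
    and AB: "A \<noteq> {}" "B \<noteq> {}" "A \<inter> B = {}" "v \<notin> A \<union> B"
    and no: "\<And>a b. a \<in> A \<Longrightarrow> b \<in> B \<Longrightarrow> \<not> h a b"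
  shows "\<exists>A' B' k. A' \<noteq> {} \<and> B' \<noteq> {} \<and> A' \<inter> B' = {} \<and> A' \<union> B' = insert v (A \<union> B) \<and>
    (\<forall>a\<in>A'. \<forall>b\<in>B'. h a b = k)"
proof -
  have no': "\<not> h b a" if "a \<in> A" "b \<in> B" for a b
    using no[OF that] unfolding sym[of b a] .
  consider "\<forall>a\<in>A. \<not> h v a" | "\<forall>b\<in>B. \<not> h v b"
    | (both) a b where "a \<in> A" "b \<in> B" "h v a" "h v b" by auto
  then show ?thesis
  proof cases
    case 1
    then have "\<not> h a v" if "a \<in> A" for a using that unfolding sym[of a v] by simp
    then show ?thesis
      using AB no by (intro exI[of _ A] exI[of _ "insert v B"] exI[of _ False]) auto
  next
    case 2
    then show ?thesis
      using AB no by (intro exI[of _ "insert v A"] exI[of _ B] exI[of _ False]) auto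
  next
    case both
    have N: "\<not> h p q" if p: "p \<in> A \<union> B" "h v p" and q: "q \<in> A \<union> B" "\<not> h v q" for p q
    proof
      assume pq: "h p q"
      \<comment> \<open>Being adjacent, \<open>p\<close> and \<open>q\<close> lie in the same part.
        Any neighbour \<open>r\<close> of \<open>v\<close> in the other part completes the induced
        path \<open>q\<close>, \<open>p\<close>, \<open>v\<close>, \<open>r\<close>.\<close>
      have "\<exists>r\<in>A \<union> B. h v r \<and> \<not> h p r \<and> \<not> h q r"
      proof (cases "p \<in> A")
        case True
        then have "q \<in> A" using no[of p q] pq q(1) by auto
        then show ?thesis using no both True by (intro bexI[of _ b]) simp_all
      next
        case False
        then have "p \<in> B" using p(1) by simp
        then have "q \<in> B" using no'[of q p] pq q(1) by auto
        then show ?thesis using no' both \<open>p \<in> B\<close> by (intro bexI[of _ a]) simp_all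
      qed
      then obtain r where r: "r \<in> A \<union> B" "h v r" "\<not> h p r" "\<not> h q r" by auto
      have "h q p" "h p v" using pq p(2) sym[of q p] sym[of p v] by simp_all
      moreover have "\<not> h q v" using q(2) sym[of q v] by simp
      moreover have "v \<noteq> p" "v \<noteq> q" "v \<noteq> r" using AB(4) p(1) q(1) r(1) by auto
      moreover have "p \<noteq> q" "q \<noteq> r" "p \<noteq> r" using p(2) q(2) r pq \<open>h q p\<close> by auto
      ultimately have "induces_P4 h q p v r"
        unfolding induces_P4_def using r by simp
      moreover have "{q, p, v, r} \<subseteq> insert v (A \<union> B)" using p(1) q(1) r(1) by simp
      ultimately show False using free by simp
    qed
    let ?N = "{p \<in> A \<union> B. h v p}" and ?N' = "{p \<in> A \<union> B. \<not> h v p}"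
    show ?thesis
    proof (cases "?N' = {}")
      case True
      then show ?thesis
        using AB by (intro exI[of _ "{v}"] exI[of _ "A \<union> B"] exI[of _ True]) auto
    next
      case False
      have "insert v ?N \<noteq> {}" by simp
      moreover have "insert v ?N \<inter> ?N' = {}" "insert v ?N \<union> ?N' = insert v (A \<union> B)"
        using AB(4) by auto
      moreover have "\<forall>a\<in>insert v ?N. \<forall>b\<in>?N'. h a b = False" using N by simp
      ultimately show ?thesis
        using False by (intro exI[of _ "insert v ?N"] exI[of _ ?N'] exI[of _ False] conjI) assumption+
    qed
  qed
qed

text \<open>Seinsche's theorem on cographs: the graph or its complement is disconnected. The
  induction adds one vertex at a time.\<close>

lemma P4_free_decomposition:
  assumes sym: "\<And>x y. h x y = h y x"
    and "finite S" "2 \<le> card S"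
    and "\<And>a b c d. {a, b, c, d} \<subseteq> S \<Longrightarrow> \<not> induces_P4 h a b c d"
  shows "\<exists>A B k. A \<noteq> {} \<and> B \<noteq> {} \<and> A \<inter> B = {} \<and> A \<union> B = S \<and> (\<forall>a\<in>A. \<forall>b\<in>B. h a b = k)"
  using assms(2-)
proof (induction S rule: finite_induct)
  case empty
  then show ?case by simp
next
  case (insert v S)
  show ?case
  proof (cases "card S = 1")
    case True
    then obtain s where "S = {s}" using card_1_singletonE by blast
    then show ?thesis using insert.hyps
      by (intro exI[of _ "{v}"] exI[of _ "{s}"] exI[of _ "h v s"]) auto
  next
    case False
    then have "2 \<le> card S" using insert by auto
    moreover have "\<not> induces_P4 h a b c d" if "{a, b, c, d} \<subseteq> S" for a b c d
      by (rule insert.prems(2)) (use that in auto)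
    ultimately have "\<exists>A B k. A \<noteq> {} \<and> B \<noteq> {} \<and> A \<inter> B = {} \<and> A \<union> B = S \<and>
        (\<forall>a\<in>A. \<forall>b\<in>B. h a b = k)"
      by (rule insert.IH)
    then obtain A B k where AB: "A \<noteq> {}" "B \<noteq> {}" "A \<inter> B = {}" "A \<union> B = S"
      "\<forall>a\<in>A. \<forall>b\<in>B. h a b = k"
      by (elim exE conjE)
    \<comment> \<open>The path on four vertices is self-complementary, so complementing \<open>h\<close> if \<open>k\<close> holds
      preserves the hypotheses.\<close>
    define g where "g x y = (h x y \<noteq> k)" for x y
    have gsym: "g x y = g y x" for x y unfolding g_def sym[of x y] by (rule refl)
    have gfree: "\<not> induces_P4 g a b c d" if "{a, b, c, d} \<subseteq> insert v (A \<union> B)" for a b c d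
    proof
      assume g: "induces_P4 g a b c d"
      \<comment> \<open>The complement of the path \<open>a\<close>, \<open>b\<close>,
        \<open>c\<close>, \<open>d\<close> is the path \<open>b\<close>, \<open>d\<close>,
        \<open>a\<close>, \<open>c\<close>.\<close>
      have "induces_P4 h a b c d \<or> induces_P4 h b d a c"
      proof (cases k)
        case True
        then show ?thesis
          using g sym[of d a] sym[of b a] sym[of d c] sym[of b c]
          unfolding induces_P4_def g_def by auto
      next
        case False
        then show ?thesis using g unfolding induces_P4_def g_def by simp
      qed
      moreover have "{a, b, c, d} \<subseteq> insert v S" "{b, d, a, c} \<subseteq> insert v S"
        using that AB(4) by auto
      ultimately show False using insert.prems(2)[of a b c d] insert.prems(2)[of b d a c] by simp
    qed
    have "\<not> g a b" if "a \<in> A" "b \<in> B" for a b using AB(5) that unfolding g_def by simp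
    then have "\<exists>A' B' k'. A' \<noteq> {} \<and> B' \<noteq> {} \<and> A' \<inter> B' = {} \<and> A' \<union> B' = insert v (A \<union> B) \<and>
        (\<forall>a\<in>A'. \<forall>b\<in>B'. g a b = k')"
      using gfree AB(1-4) insert.hyps(2) by (intro P4_free_step[OF gsym]) simp_all
    then obtain A' B' k' where A'B': "A' \<noteq> {}" "B' \<noteq> {}" "A' \<inter> B' = {}" "A' \<union> B' = insert v S"
      "\<forall>a\<in>A'. \<forall>b\<in>B'. g a b = k'"
      unfolding AB(4) by (elim exE conjE)
    have "\<forall>a\<in>A'. \<forall>b\<in>B'. h a b = (k' \<noteq> k)" using A'B'(5) unfolding g_def by auto
    then show ?thesis using A'B'
      by (intro exI[of _ A'] exI[of _ B'] exI[of _ "k' \<noteq> k"] conjI) assumption+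
  qed
qed

section \<open>Nonseparable sets of order five\<close>

context symmetric_relation
begin

text \<open>Let \<open>M\<close> be the side without \<open>p\<close>. Column \<open>p\<close> is
  constant on \<open>M\<close>, hence so is every column outside \<open>M\<close>, which makes
  \<open>M\<close> a module of the path. A module of this path with two vertices is the whole path,
  leaving only \<open>p\<close> on the other side.\<close>

lemma isolated_P4_not_separable:
  assumes p: "p \<notin> {a, b, c, d}" "\<And>x. x \<in> {a, b, c, d} \<Longrightarrow> e p x = k"
    and P4: "induces_P4 e a b c d"
  shows "\<not> separable {p, a, b, c, d}"
proof
  let ?S = "{p, a, b, c, d}"
  assume "separable ?S"
  then obtain W where W: "W \<subseteq> ?S" "2 \<le> card W" "2 \<le> card (?S - W)" "splits W (?S - W)"
    unfolding separable_def by auto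
  have "\<exists>M\<subseteq>?S. p \<notin> M \<and> 2 \<le> card M \<and> 2 \<le> card (?S - M) \<and> splits M (?S - M)"
  proof (cases "p \<in> W")
    case True
    have "?S - (?S - W) = W" using W(1) by blast
    then show ?thesis
      using W splits_commute[OF W(4)] True by (intro exI[of _ "?S - W"]) auto
  next
    case False
    then show ?thesis using W by (intro exI[of _ W]) simp
  qed
  then obtain M where M: "M \<subseteq> ?S" "p \<notin> M" "2 \<le> card M" "2 \<le> card (?S - M)" "splits M (?S - M)"
    by (elim exE conjE)
  have M_sub: "M \<subseteq> {a, b, c, d}" using M(1,2) by auto
  have closed: "v \<in> M" if "w \<in> M" "w' \<in> M" "v \<in> {a, b, c, d}" "e w v" "\<not> e w' v" for w w' v
  proof (rule ccontr)
    assume "v \<notin> M"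
    then have "(e w v = e w p) = (e w' v = e w' p)"
      using splitsD[OF M(5) that(1,2), of v p] that(3) M(2) by simp
    moreover have "e w p = k" "e w' p = k"
      unfolding sym[of w p] sym[of w' p] by (intro p(2) subsetD[OF M_sub] that)+
    ultimately show False using that(4,5) by (cases k) simp_all
  qed
  have P4: "e b a" "e c b" "e b c" "e c d" "e d c"
    "\<not> e c a" "\<not> e a c" "\<not> e a d" "\<not> e d a" "\<not> e d b" "\<not> e b d"
    using P4 sym[of b a] sym[of c b] sym[of d c] sym[of c a] sym[of d a] sym[of d b]
    unfolding induces_P4_def by simp_all
  \<comment> \<open>Starting from any two path vertices, these implications generate all
    four.\<close>
  have step: "a \<in> M \<Longrightarrow> b \<in> M \<Longrightarrow> c \<in> M" "a \<in> M \<Longrightarrow> c \<in> M \<Longrightarrow> d \<in> M"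
    "a \<in> M \<Longrightarrow> d \<in> M \<Longrightarrow> c \<in> M" "b \<in> M \<Longrightarrow> c \<in> M \<Longrightarrow> d \<in> M" "b \<in> M \<Longrightarrow> c \<in> M \<Longrightarrow> a \<in> M"
    "b \<in> M \<Longrightarrow> d \<in> M \<Longrightarrow> a \<in> M" "c \<in> M \<Longrightarrow> d \<in> M \<Longrightarrow> b \<in> M"
    by (rule closed[of b a c] closed[of c a d] closed[of d a c] closed[of c b d] closed[of b c a]
      closed[of b d a] closed[of c d b]; simp add: P4)+
  have "\<not> card M \<le> Suc 0" "finite M" using M(3) finite_subset[OF M_sub] by simp_all
  then obtain w w' where "w \<in> M" "w' \<in> M" "w \<noteq> w'" by (auto simp: card_le_Suc0_iff_eq)
  then have "a \<in> M \<and> b \<in> M \<or> a \<in> M \<and> c \<in> M \<or> a \<in> M \<and> d \<in> M \<or>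
      b \<in> M \<and> c \<in> M \<or> b \<in> M \<and> d \<in> M \<or> c \<in> M \<and> d \<in> M"
    using M_sub by auto
  then have "a \<in> M \<and> b \<in> M \<and> c \<in> M \<and> d \<in> M"
    by (elim disjE conjE) (blast intro: step)+
  then have "?S - M = {p}" using M(2) by auto
  then show False using M(4) by simp
qed

text \<open>Each row of \<open>insert p A\<close> is constant on \<open>B\<close>, so the two sets
  split \<open>S\<close>; likewise with \<open>A\<close> and \<open>B\<close> exchanged. As
  \<open>S\<close> has at least four vertices, \<open>A\<close> or \<open>B\<close> has two and can
  be the side without \<open>p\<close>.\<close>

lemma separable_if_decomposition:
  assumes S: "S = insert p (A \<union> B)" "finite S" "4 \<le> card S"
    and AB: "A \<noteq> {}" "B \<noteq> {}" "A \<inter> B = {}" "p \<notin> A \<union> B"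
    and p: "\<And>x. x \<in> A \<union> B \<Longrightarrow> e p x = k"
    and e: "\<And>a b. a \<in> A \<Longrightarrow> b \<in> B \<Longrightarrow> e a b = l"
  shows "separable S"
proof -
  have *: "separable S"
    if prems: "S = insert p (A \<union> B)" "A \<noteq> {}" "2 \<le> card B" "A \<inter> B = {}" "p \<notin> A \<union> B"
      "\<And>x. x \<in> A \<union> B \<Longrightarrow> e p x = k" "\<And>a b. a \<in> A \<Longrightarrow> b \<in> B \<Longrightarrow> e a b = l" for A B
  proof -
    have const: "e w v = e w v'" if "w \<in> insert p A" "v \<in> B" "v' \<in> B" for w v v'
    proof (cases "w = p")
      case True
      then show ?thesis using prems(6)[of v] prems(6)[of v'] that by simp
    next
      case False
      then show ?thesis using prems(7)[of w v] prems(7)[of w v'] that by simp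
    qed
    have "splits (insert p A) B"
      unfolding splits_def
    proof (intro ballI)
      fix w w' v v'
      assume "w \<in> insert p A" "w' \<in> insert p A" "v \<in> B" "v' \<in> B"
      then have "e w v = e w v'" "e w' v = e w' v'" using const[of w v v'] const[of w' v v'] by simp_all
      then show "(e w v = e w v') = (e w' v = e w' v')" by (simp only: simp_thms)
    qed
    moreover have "S - insert p A = B" using prems(1,4,5) by auto
    moreover have "finite A" using prems(1) S(2) by simp
    then have "2 \<le> card (insert p A)"
      using prems(2,5) by (simp add: Suc_le_eq card_gt_0_iff)
    ultimately show ?thesis
      unfolding separable_def using prems(1,3) by (intro exI[of _ "insert p A"]) auto
  qed
  have "card S = Suc (card A + card B)"
    using S(1,2) AB by (simp add: card_Un_disjoint)
  then consider "2 \<le> card A" | "2 \<le> card B" using S(3) by linarith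
  then show ?thesis
  proof cases
    case 1
    have "e b a = l" if "b \<in> B" "a \<in> A" for a b
      using e[OF that(2,1)] unfolding sym[of b a] .
    then show ?thesis
      by (intro *[of B A]) (use 1 S AB p in auto)
  next
    case 2
    show ?thesis
      by (rule *[of A B]) (use 2 S AB p e in auto)
  qed
qed

text \<open>The adjacency relation of the switching that isolates \<open>p\<close>.\<close>

definition pivot :: "'a \<Rightarrow> 'a \<Rightarrow> 'a \<Rightarrow> bool" where
  "pivot p x y = (e x y = (e p x = e p y))"

lemma symmetric_pivot: "symmetric_relation (pivot p)"
proof
  show "pivot p x y = pivot p y x" for x y
    unfolding pivot_def sym[of y x] by argo
qed

text \<open>In the sum over a 2 by 2 block each added entry of row \<open>p\<close> occurs twice and
  cancels.\<close>

lemma separable_pivot: "symmetric_relation.separable (pivot p) S = separable S"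
proof -
  interpret pivot: symmetric_relation "pivot p" by (rule symmetric_pivot)
  have "((pivot p w v = pivot p w v') = (pivot p w' v = pivot p w' v')) =
      ((e w v = e w v') = (e w' v = e w' v'))" for w w' v v'
    unfolding pivot_def by argo
  then show ?thesis
    unfolding pivot.separable_def pivot.splits_def separable_def splits_def by simp
qed

lemma nonseparable_five_subset:
  assumes V: "\<not> separable V" "finite V" "4 \<le> card V"
  shows "\<exists>X\<subseteq>V. card X = 5 \<and> \<not> separable X"
proof -
  have "V \<noteq> {}" using V(3) by auto
  then obtain p where p: "p \<in> V" by auto
  interpret pivot: symmetric_relation "pivot p" by (rule symmetric_pivot)
  \<comment> \<open>The diagonal of \<open>e\<close> is arbitrary, so the row of \<open>p\<close> is
    constant with value \<open>e p p\<close> rather than \<open>False\<close>.\<close>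
  have pp: "pivot p p x = e p p" for x unfolding pivot_def by argo
  have card: "card (V - {p}) = card V - 1" using p by simp
  show ?thesis
  proof (cases "\<exists>a b c d. {a, b, c, d} \<subseteq> V - {p} \<and> induces_P4 (pivot p) a b c d")
    case True
    then obtain a b c d where P4: "{a, b, c, d} \<subseteq> V - {p}" "induces_P4 (pivot p) a b c d"
      by (elim exE conjE)
    have "\<not> pivot.separable {p, a, b, c, d}"
      by (rule pivot.isolated_P4_not_separable[OF _ pp P4(2)]) (use P4(1) in auto)
    moreover have "card {p, a, b, c, d} = 5"
      using P4 unfolding induces_P4_def by auto
    moreover have "{p, a, b, c, d} \<subseteq> V" using P4(1) p by auto
    ultimately show ?thesis unfolding separable_pivot by (intro exI[of _ "{p, a, b, c, d}"]) simp
  next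
    case False
    have "\<exists>A B k. A \<noteq> {} \<and> B \<noteq> {} \<and> A \<inter> B = {} \<and> A \<union> B = V - {p} \<and>
        (\<forall>a\<in>A. \<forall>b\<in>B. pivot p a b = k)"
      by (rule P4_free_decomposition[OF pivot.sym]) (use V card False in auto)
    then obtain A B k where AB: "A \<noteq> {}" "B \<noteq> {}" "A \<inter> B = {}" "A \<union> B = V - {p}"
      "\<forall>a\<in>A. \<forall>b\<in>B. pivot p a b = k"
      by (elim exE conjE)
    have "pivot.separable V"
      by (rule pivot.separable_if_decomposition[OF _ V(2,3) AB(1-3) _ pp])
        (use AB(4,5) p in auto)
    then show ?thesis using V(1) unfolding separable_pivot by simp
  qed
qed

section \<open>Growth to codimension at most two and translation to switchings\<close>

text \<open>Steps of two preserve the parity of the order, so the parities of \<open>card X\<close>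
  and \<open>card V\<close> decide which of the two codimensions this growth reaches.\<close>

lemma nonseparable_codimension_le_two:
  assumes V: "\<not> separable V" "finite V"
    and X: "\<not> separable X" "X \<subseteq> V" "4 \<le> card X" "card X < card V"
  shows "\<exists>Y\<subseteq>V. (card Y + 1 = card V \<or> card Y + 2 = card V) \<and> \<not> separable Y"
  using X
proof (induction "card V - card X" arbitrary: X rule: less_induct)
  case less
  show ?case
  proof (cases "card X + 1 = card V \<or> card X + 2 = card V")
    case True
    then show ?thesis using less.prems by (intro exI[of _ X]) simp
  next
    case False
    then have le: "card X + 2 < card V" using less.prems by linarith
    then obtain Y where Y: "Y \<subseteq> V" "card Y = card X + 2" "\<not> separable Y"
      using nonseparable_two_extension[OF V less.prems(1-3)] by auto
    then show ?thesis using le less.prems(3) by (intro less.hyps[of Y]) auto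
  qed
qed

text \<open>A switching clears the block between \<open>W\<close> and \<open>S - W\<close> iff the
  block is a sum mod 2 of a function of the row and a function of the column; the parity condition
  characterises such blocks. As \<open>e\<close> must match \<open>F\<close> on \<open>S\<close>
  only, one relation serves all induced subgraphs.\<close>

lemma switching_separable_iff:
  assumes S: "finite S" and e: "\<And>x y. x \<in> S \<Longrightarrow> y \<in> S \<Longrightarrow> {x, y} \<in> F \<longleftrightarrow> e x y"
  shows "switching_separable S F \<longleftrightarrow> separable S"
proof -
  have bip: "{w, v} \<in> complete_bipartite_edges U (S - U) \<longleftrightarrow> (w \<in> U) \<noteq> (v \<in> U)"
    if "w \<in> S" "v \<in> S" for w v U
    using that unfolding complete_bipartite_edges_def by (auto simp: doubleton_eq_iff)
  have sw: "{w, v} \<notin> switching S F U \<longleftrightarrow> (e w v \<longleftrightarrow> (w \<in> U) \<noteq> (v \<in> U))"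
    if "w \<in> S" "v \<in> S" for w v U
    unfolding switching_def using bip[OF that] e[OF that] by auto
  have iso: "isolable S F W \<longleftrightarrow> W \<subseteq> S \<and> 2 \<le> card W \<and> 2 \<le> card (S - W) \<and> splits W (S - W)" for W
  proof -
    have "(\<exists>U\<subseteq>S. \<forall>w\<in>W. \<forall>v\<in>S - W. {w, v} \<notin> switching S F U) \<longleftrightarrow> splits W (S - W)"
      if W: "W \<subseteq> S" "2 \<le> card W" "2 \<le> card (S - W)"
    proof
      assume "\<exists>U\<subseteq>S. \<forall>w\<in>W. \<forall>v\<in>S - W. {w, v} \<notin> switching S F U"
      then obtain U where U: "\<forall>w\<in>W. \<forall>v\<in>S - W. {w, v} \<notin> switching S F U" by (elim exE conjE)
      have U: "e w v \<longleftrightarrow> (w \<in> U) \<noteq> (v \<in> U)" if "w \<in> W" "v \<in> S - W" for w v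
        using U that W(1) sw[of w v U] by auto
      show "splits W (S - W)"
        unfolding splits_def
      proof (intro ballI)
        fix w w' v v'
        assume "w \<in> W" "w' \<in> W" "v \<in> S - W" "v' \<in> S - W"
        then have "e w v = ((w \<in> U) \<noteq> (v \<in> U))" "e w v' = ((w \<in> U) \<noteq> (v' \<in> U))"
          "e w' v = ((w' \<in> U) \<noteq> (v \<in> U))" "e w' v' = ((w' \<in> U) \<noteq> (v' \<in> U))"
          by (simp_all only: U)
        then show "(e w v = e w v') = (e w' v = e w' v')" by argo
      qed
    next
      assume sp: "splits W (S - W)"
      have "W \<noteq> {}" "S - W \<noteq> {}" using W by force+
      then obtain w0 v0 where wv: "w0 \<in> W" "v0 \<in> S - W" by auto
      \<comment> \<open>The row function is read off column \<open>v0\<close>, the column function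
        off row \<open>w0\<close>; the comparison with \<open>e w0 v0\<close> corrects for the entry
        counted in both.\<close>
      define U where "U = {w \<in> W. e w v0} \<union> {v \<in> S - W. e w0 v \<noteq> e w0 v0}"
      have "{w, v} \<notin> switching S F U" if "w \<in> W" "v \<in> S - W" for w v
      proof -
        have "w \<in> U \<longleftrightarrow> e w v0" "v \<in> U \<longleftrightarrow> e w0 v \<noteq> e w0 v0"
          using that unfolding U_def by auto
        moreover have "(e w v = e w v0) = (e w0 v = e w0 v0)"
          by (rule splitsD[OF sp]) (use that wv in auto)
        ultimately have "e w v \<longleftrightarrow> (w \<in> U) \<noteq> (v \<in> U)" by argo
        then show ?thesis using sw[of w v U] that W(1) by auto
      qed
      moreover have "U \<subseteq> S" using W(1) unfolding U_def by auto
      ultimately show "\<exists>U\<subseteq>S. \<forall>w\<in>W. \<forall>v\<in>S - W. {w, v} \<notin> switching S F U"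
        by (intro exI[of _ U]) simp
    qed
    moreover have "card W + 2 \<le> card S \<longleftrightarrow> 2 \<le> card (S - W)" if "W \<subseteq> S"
      using that S card_mono[OF S that] by (simp add: card_Diff_subset finite_subset le_diff_conv2)
    ultimately show ?thesis unfolding isolable_def by argo
  qed
  then show ?thesis unfolding switching_separable_def separable_def by (intro ex_cong1) (rule iso)
qed

end

theorem theorem1:
  fixes V :: "'a set" and E :: "'a set set" and n :: nat
  assumes "simple_graph V E"
    and "card V = n"
    and "n \<ge> 4"
    and "\<And>S. S \<subseteq> V \<Longrightarrow> card S = n - 1 \<Longrightarrow> switching_separable S (induced_edges E S)"
    and "\<And>S. S \<subseteq> V \<Longrightarrow> card S = n - 2 \<Longrightarrow> switching_separable S (induced_edges E S)"
  shows "switching_separable V E"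
proof (rule ccontr)
  assume nonsep: "\<not> switching_separable V E"
  interpret symmetric_relation "\<lambda>x y. {x, y} \<in> E"
    by standard (simp add: insert_commute)
  have fin: "finite V" using assms(1) unfolding simple_graph_def by simp
  have ind: "switching_separable S (induced_edges E S) \<longleftrightarrow> separable S" if "S \<subseteq> V" for S
    by (rule switching_separable_iff[OF finite_subset[OF that fin]])
      (simp add: induced_edges_def)
  have V: "\<not> separable V"
    using nonsep switching_separable_iff[OF fin, of E] by simp
  then obtain X where X: "X \<subseteq> V" "card X = 5" "\<not> separable X"
    using nonseparable_five_subset fin assms(2,3) by blast
  \<comment> \<open>A separable graph has at least four vertices, so applying the assumption to one
    set of order \<open>n - 2\<close> gives \<open>n \<ge> 6\<close>; hence the five-vertex set
    \<open>X\<close> is proper.\<close>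
  obtain S where S: "S \<subseteq> V" "card S = n - 2"
    using obtain_subset_with_card_n[of "n - 2" V] assms(2) by auto
  have "switching_separable S (induced_edges E S)" by (rule assms(5)[OF S])
  then have "4 \<le> card S" unfolding switching_separable_def isolable_def by auto
  then have "card X < card V" using S(2) X(2) assms(2) by linarith
  then obtain Y where Y: "Y \<subseteq> V" "card Y + 1 = n \<or> card Y + 2 = n" "\<not> separable Y"
    using nonseparable_codimension_le_two[OF V fin X(3,1)] X(2) assms(2) by auto
  then have "card Y = n - 1 \<or> card Y = n - 2" by linarith
  then show False using assms(4,5)[OF Y(1)] ind[OF Y(1)] Y(3) by auto
qed

end
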